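(* Every frame matroid is quasi-graphic.
   Context: For a graph $G$ and a vertex $v$, $\mathrm{loops}_G(v)$ denotes the set of loop-edges of $G$ at $v$. Graphs are finite and may have loops and parallel edges. For a set $X$ of edges, $G[X]$ is the subgraph of $G$ with edge-set $X$ and no isolated vertices. A graph $G$ is a framework for a matroid $M$ if (1) $E(G)=E(M)$; (2) $r_M(E(H))\le |V(H)|$ for each component $H$ of $G$; (3) for each vertex $v$ of $G$, $\mathrm{cl}_M(E(G-v))\subseteq E(G-v)\cup \mathrm{loops}_G(v)$; and (4) for each circuit $C$ of $M$, the subgraph $G[C]$ has at most two components. A matroid is quasi-graphic if it has a framework. A framed matroid is a pair $(M,V)$ where $M$ is a matroid, $V$ is a basis of $M$, and each element of $M$ is spanned by a subset of $V$ with at most two elements. A matroid $M$ is a frame matroid if there is a framed matroid $(M',V)$ with $M=M'\setminus V$. *)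

theory Defs
  imports "HOL-Library.Countable_Set"
begin

section \<open>Matroids\<close>

record 'a pre_matroid =
  ground :: "'a set"
  indeps :: "'a set set"

locale matroid =
  fixes M :: "'a pre_matroid"
  assumes finite_ground: "finite (ground M)"
    and indeps_subset: "I \<in> indeps M \<Longrightarrow> I \<subseteq> ground M"
    and empty_indep: "{} \<in> indeps M"
    and indep_subset: "I \<in> indeps M \<Longrightarrow> J \<subseteq> I \<Longrightarrow> J \<in> indeps M"
    and augment: "I \<in> indeps M \<Longrightarrow> J \<in> indeps M \<Longrightarrow> card I < card J
      \<Longrightarrow> \<exists>x \<in> J - I. insert x I \<in> indeps M"

definition matroid_rank :: "'a pre_matroid \<Rightarrow> 'a set \<Rightarrow> nat" where
  "matroid_rank M X = Max (card ` {I \<in> indeps M. I \<subseteq> X})"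

definition matroid_closure :: "'a pre_matroid \<Rightarrow> 'a set \<Rightarrow> 'a set" where
  "matroid_closure M X = {e \<in> ground M. matroid_rank M (insert e X) = matroid_rank M X}"

definition matroid_basis :: "'a pre_matroid \<Rightarrow> 'a set \<Rightarrow> bool" where
  "matroid_basis M B \<longleftrightarrow> B \<in> indeps M \<and> (\<forall>I \<in> indeps M. B \<subseteq> I \<longrightarrow> I = B)"

definition matroid_circuit :: "'a pre_matroid \<Rightarrow> 'a set \<Rightarrow> bool" where
  "matroid_circuit M C \<longleftrightarrow>
     C \<subseteq> ground M \<and> C \<notin> indeps M \<and> (\<forall>D. D \<subset> C \<longrightarrow> D \<in> indeps M)"

definition matroid_delete :: "'a pre_matroid \<Rightarrow> 'a set \<Rightarrow> 'a pre_matroid" where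
  "matroid_delete M D = \<lparr>ground = ground M - D, indeps = {I \<in> indeps M. I \<inter> D = {}}\<rparr>"

definition map_matroid :: "('a \<Rightarrow> 'b) \<Rightarrow> 'a pre_matroid \<Rightarrow> 'b pre_matroid" where
  "map_matroid f M = \<lparr>ground = f ` ground M, indeps = (`) f ` indeps M\<rparr>"


section \<open>Frame matroids\<close>

definition framed_matroid :: "'a pre_matroid \<Rightarrow> 'a set \<Rightarrow> bool" where
  "framed_matroid M V \<longleftrightarrow> matroid M \<and> matroid_basis M V \<and>
     (\<forall>e \<in> ground M. \<exists>S \<subseteq> V. card S \<le> 2 \<and> e \<in> matroid_closure M S)"

text \<open>
  The matroid \<open>M'\<close> has elements outside \<open>M\<close>, for which the type \<open>'a\<close> may have no room.
  It therefore lives on \<open>'a + nat\<close>, with \<open>M\<close> embedded by \<open>Inl\<close>. As matroids are finite, this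
  loses no generality: see \<open>frame_matroidI\<close> below, where \<open>M'\<close> is over an arbitrary type.
\<close>

definition frame_matroid :: "'a pre_matroid \<Rightarrow> bool" where
  "frame_matroid M \<longleftrightarrow> matroid M \<and>
     (\<exists>(M' :: ('a + nat) pre_matroid) V.
        framed_matroid M' V \<and> map_matroid Inl M = matroid_delete M' V)"


section \<open>Graphs\<close>

text \<open>
  Finite undirected graphs with loops and parallel edges: a loop has one end, any other edge has
  two.
\<close>

record ('v, 'e) pre_multigraph =
  verts :: "'v set"
  edges :: "'e set"
  ends :: "'e \<Rightarrow> 'v set"

locale multigraph =
  fixes G :: "('v, 'e) pre_multigraph"
  assumes finite_verts: "finite (verts G)"
    and finite_edges: "finite (edges G)"
    and ends_in_verts: "e \<in> edges G \<Longrightarrow> ends G e \<subseteq> verts G"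
    and card_ends: "e \<in> edges G \<Longrightarrow> card (ends G e) = 1 \<or> card (ends G e) = 2"

definition loops :: "('v, 'e) pre_multigraph \<Rightarrow> 'v \<Rightarrow> 'e set" where
  "loops G v = {e \<in> edges G. ends G e = {v}}"

definition delete_vertex :: "('v, 'e) pre_multigraph \<Rightarrow> 'v \<Rightarrow> ('v, 'e) pre_multigraph" where
  "delete_vertex G v =
     \<lparr>verts = verts G - {v}, edges = {e \<in> edges G. v \<notin> ends G e}, ends = ends G\<rparr>"

definition edge_subgraph :: "('v, 'e) pre_multigraph \<Rightarrow> 'e set \<Rightarrow> ('v, 'e) pre_multigraph" where
  "edge_subgraph G X = \<lparr>verts = (\<Union>e \<in> X. ends G e), edges = X, ends = ends G\<rparr>"

text \<open>
  Demanding that the functions \<open>ends\<close> agree everywhere, not only on the edges of \<open>H\<close>, makes a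
  subgraph determined by its vertices and edges, so that components are counted correctly.
\<close>

definition is_subgraph :: "('v, 'e) pre_multigraph \<Rightarrow> ('v, 'e) pre_multigraph \<Rightarrow> bool" where
  "is_subgraph H G \<longleftrightarrow> multigraph H \<and>
     verts H \<subseteq> verts G \<and> edges H \<subseteq> edges G \<and> ends H = ends G"

definition adjacency :: "('v, 'e) pre_multigraph \<Rightarrow> ('v \<times> 'v) set" where
  "adjacency G = {(u, v). \<exists>e \<in> edges G. ends G e = {u, v}}"

definition connected_graph :: "('v, 'e) pre_multigraph \<Rightarrow> bool" where
  "connected_graph G \<longleftrightarrow>
     verts G \<noteq> {} \<and> (\<forall>u \<in> verts G. \<forall>v \<in> verts G. (u, v) \<in> (adjacency G)\<^sup>*)"

definition components :: "('v, 'e) pre_multigraph \<Rightarrow> ('v, 'e) pre_multigraph set" where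
  "components G = {H. is_subgraph H G \<and> connected_graph H \<and>
     (\<forall>K. is_subgraph K G \<and> connected_graph K \<and> is_subgraph H K \<longrightarrow> K = H)}"


section \<open>Quasi-graphic matroids\<close>

definition framework :: "('v, 'a) pre_multigraph \<Rightarrow> 'a pre_matroid \<Rightarrow> bool" where
  "framework G M \<longleftrightarrow> multigraph G \<and>
     edges G = ground M \<and>
     (\<forall>H \<in> components G. matroid_rank M (edges H) \<le> card (verts H)) \<and>
     (\<forall>v \<in> verts G. matroid_closure M (edges (delete_vertex G v))
        \<subseteq> edges (delete_vertex G v) \<union> loops G v) \<and>
     (\<forall>C. matroid_circuit M C \<longrightarrow> card (components (edge_subgraph G C)) \<le> 2)"

text \<open>Graphs being finite, their vertices may be taken to be natural numbers.\<close>

definition quasi_graphic :: "'a pre_matroid \<Rightarrow> bool" where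
  "quasi_graphic M \<longleftrightarrow> matroid M \<and> (\<exists>G :: (nat, 'a) pre_multigraph. framework G M)"


section \<open>Independence of the definition of frame matroids from the choice of types\<close>

lemma matroid_map:
  assumes "matroid M" and inj: "inj_on f (ground M)"
  shows "matroid (map_matroid f M)"
proof -
  interpret matroid M by fact
  have card_eq: "card (f ` I) = card I" if "I \<in> indeps M" for I
    using that by (meson card_image indeps_subset inj inj_on_subset)
  show ?thesis
  proof
    show "finite (ground (map_matroid f M))"
      using finite_ground by (simp add: map_matroid_def)
    show "I \<subseteq> ground (map_matroid f M)" if "I \<in> indeps (map_matroid f M)" for I
      using that indeps_subset by (auto simp: map_matroid_def)
    show "{} \<in> indeps (map_matroid f M)"
      using empty_indep by (auto simp: map_matroid_def)
    show "J \<in> indeps (map_matroid f M)" if "I \<in> indeps (map_matroid f M)" "J \<subseteq> I" for I J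
    proof -
      obtain I0 where I0: "I0 \<in> indeps M" "I = f ` I0"
        using \<open>I \<in> indeps (map_matroid f M)\<close> by (auto simp: map_matroid_def)
      then obtain J0 where "J0 \<subseteq> I0" "J = f ` J0"
        using \<open>J \<subseteq> I\<close> by (auto simp: subset_image_iff)
      then show ?thesis using I0 indep_subset by (auto simp: map_matroid_def)
    qed
    show "\<exists>x \<in> J - I. insert x I \<in> indeps (map_matroid f M)"
      if IJ: "I \<in> indeps (map_matroid f M)" "J \<in> indeps (map_matroid f M)" "card I < card J" for I J
    proof -
      obtain I0 J0 where I0: "I0 \<in> indeps M" "I = f ` I0" and J0: "J0 \<in> indeps M" "J = f ` J0"
        using IJ by (auto simp: map_matroid_def)
      then obtain x where x: "x \<in> J0 - I0" "insert x I0 \<in> indeps M"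
        using augment[of I0 J0] IJ card_eq by auto
      have "f x \<in> J - I"
        using x I0 J0 indeps_subset[of I0] indeps_subset[of J0] inj_on_image_mem_iff[OF inj, of x I0]
        by auto
      moreover have "insert (f x) I \<in> indeps (map_matroid f M)"
        using x I0 by (auto simp: map_matroid_def intro!: image_eqI[where x = "insert x I0"])
      ultimately show ?thesis by blast
    qed
  qed
qed

lemma rank_map:
  assumes "matroid M" and inj: "inj_on f (ground M)" and X: "X \<subseteq> ground M"
  shows "matroid_rank (map_matroid f M) (f ` X) = matroid_rank M X"
proof -
  interpret matroid M by fact
  have card_eq: "card (f ` I) = card I" if "I \<in> indeps M" for I
    using that by (meson card_image indeps_subset inj inj_on_subset)
  have sub: "f ` I \<subseteq> f ` X \<longleftrightarrow> I \<subseteq> X" if "I \<in> indeps M" for I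
    using inj_on_image_mem_iff[OF inj _ X] indeps_subset[OF that] by blast
  have "{I \<in> indeps (map_matroid f M). I \<subseteq> f ` X} = (`) f ` {I \<in> indeps M. I \<subseteq> X}"
    using sub by (auto simp: map_matroid_def)
  then have "card ` {I \<in> indeps (map_matroid f M). I \<subseteq> f ` X} = card ` {I \<in> indeps M. I \<subseteq> X}"
    using card_eq by (simp add: image_image)
  then show ?thesis by (simp add: matroid_rank_def)
qed

lemma framed_map:
  assumes framed: "framed_matroid M V" and inj: "inj_on f (ground M)"
  shows "framed_matroid (map_matroid f M) (f ` V)"
proof -
  interpret matroid M using framed by (simp add: framed_matroid_def)
  have M: "matroid M" ..
  have V: "V \<in> indeps M" "\<And>I. I \<in> indeps M \<Longrightarrow> V \<subseteq> I \<Longrightarrow> I = V"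
    using framed by (auto simp: framed_matroid_def matroid_basis_def)
  have sub: "f ` V \<subseteq> f ` I \<longleftrightarrow> V \<subseteq> I" if "I \<in> indeps M" for I
    using inj_on_image_mem_iff[OF inj _ indeps_subset[OF that]] indeps_subset[OF V(1)] by blast
  have "matroid_basis (map_matroid f M) (f ` V)"
    using V sub by (auto simp: matroid_basis_def map_matroid_def)
  moreover have "\<exists>S \<subseteq> f ` V. card S \<le> 2 \<and> f e \<in> matroid_closure (map_matroid f M) S"
    if e: "e \<in> ground M" for e
  proof -
    obtain S where S: "S \<subseteq> V" "card S \<le> 2" "e \<in> matroid_closure M S"
      using framed e by (auto simp: framed_matroid_def)
    have SE: "S \<subseteq> ground M" using S V indeps_subset by blast
    have "matroid_rank (map_matroid f M) (f ` insert e S) = matroid_rank (map_matroid f M) (f ` S)"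
      using S e SE by (simp only: rank_map[OF M inj] insert_subset matroid_closure_def mem_Collect_eq simp_thms)
    then have "f e \<in> matroid_closure (map_matroid f M) (f ` S)"
      using e by (simp add: matroid_closure_def) (simp add: map_matroid_def)
    moreover have "card (f ` S) \<le> 2"
      using S SE inj by (metis card_image inj_on_subset)
    ultimately show ?thesis using S by blast
  qed
  ultimately show ?thesis
    using matroid_map[OF M inj] by (auto simp: framed_matroid_def) (auto simp: map_matroid_def)
qed

lemma frame_matroidI:
  fixes M :: "'a pre_matroid" and M' :: "'b pre_matroid"
  assumes M: "matroid M" and framed: "framed_matroid M' V"
    and inj: "inj_on f (ground M)" and eq: "map_matroid f M = matroid_delete M' V"
  shows "frame_matroid M"
proof -
  interpret M: matroid M by fact
  interpret M': matroid M' using framed by (simp add: framed_matroid_def)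
  define h :: "'b \<Rightarrow> 'a + nat" where
    "h x = (if x \<in> V then Inr (to_nat_on V x) else Inl (inv_into (ground M) f x))" for x
  have VE: "V \<subseteq> ground M'"
    using framed M'.indeps_subset by (auto simp: framed_matroid_def matroid_basis_def)
  have "countable V"
    using VE M'.finite_ground by (meson countable_finite finite_subset)
  have gr: "f ` ground M = ground M' - V" and ind: "(`) f ` indeps M = {I \<in> indeps M'. I \<inter> V = {}}"
    using eq by (auto simp: map_matroid_def matroid_delete_def)
  have hf: "h (f e) = Inl e" if "e \<in> ground M" for e
    using that gr inj by (auto simp: h_def)
  have inj_h: "inj_on h (ground M')"
  proof (rule inj_onI)
    fix x y assume xy: "x \<in> ground M'" "y \<in> ground M'" "h x = h y"
    show "x = y"
    proof (cases "x \<in> V")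
      case True
      then show ?thesis using xy \<open>countable V\<close> by (auto simp: h_def split: if_splits)
    next
      case False
      then have y: "y \<notin> V" using xy by (auto simp: h_def split: if_splits)
      then obtain a b where "a \<in> ground M" "x = f a" "b \<in> ground M" "y = f b"
        using False xy gr by blast
      then show ?thesis using xy hf by simp
    qed
  qed
  have "map_matroid Inl M = matroid_delete (map_matroid h M') (h ` V)"
  proof -
    have "h ` ground M' - h ` V = h ` (ground M' - V)"
      using inj_on_image_set_diff[OF inj_h _ VE, of "ground M'"] by auto
    also have "\<dots> = Inl ` ground M"
      unfolding gr[symmetric] image_image using hf by (intro image_cong) auto
    finally have 1: "h ` ground M' - h ` V = Inl ` ground M" .
    have "h ` I \<inter> h ` V = {} \<longleftrightarrow> I \<inter> V = {}" if "I \<in> indeps M'" for I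
      using inj_on_image_Int[OF inj_h M'.indeps_subset[OF that] VE] by (metis image_is_empty)
    then have "{I \<in> (`) h ` indeps M'. I \<inter> h ` V = {}} = (`) h ` {I \<in> indeps M'. I \<inter> V = {}}"
      by auto
    also have "\<dots> = (`) Inl ` indeps M"
      unfolding ind[symmetric] image_image
      using hf M.indeps_subset by (intro image_cong refl) (auto intro!: image_cong)
    finally show ?thesis using 1 by (simp add: map_matroid_def matroid_delete_def)
  qed
  then show ?thesis
    using M framed_map[OF framed inj_h] by (auto simp: frame_matroid_def)
qed

end

theory Submission
  imports Defs
begin

text \<open>
  Let \<open>V\<close> frame \<open>M'\<close>, with \<open>M = M' \ V\<close>. Take \<open>V\<close> as vertex set and let the ends of an element be
  the smallest subset of \<open>V\<close> that spans it; the loops of the matroid, which are spanned by the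
  empty set, become graph loops at the vertex \<open>0\<close>, which need not represent an element of \<open>V\<close>. An
  element with two ends is not spanned by \<open>V\<close> without one of these ends, whence the condition on
  closures. Two vertex-disjoint sets of edges are spanned by disjoint subsets of the basis \<open>V\<close>, so
  the union of two such independent sets is independent. Hence a circuit even induces a connected
  subgraph.
\<close>

section \<open>Rank and closure\<close>

context matroid
begin

lemma finite_indeps: "finite (indeps M)"
  using finite_ground indeps_subset by (meson Pow_iff finite_Pow_iff finite_subset subsetI)

lemma finite_indep: "I \<in> indeps M \<Longrightarrow> finite I"
  using finite_ground indeps_subset finite_subset by blast

lemma card_le_rank:
  assumes "I \<in> indeps M" "I \<subseteq> X"
  shows "card I \<le> matroid_rank M X"
  unfolding matroid_rank_def using assms finite_indeps by (intro Max_ge) auto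

lemma rank_attained: obtains I where "I \<in> indeps M" "I \<subseteq> X" "card I = matroid_rank M X"
proof -
  have "matroid_rank M X \<in> card ` {I \<in> indeps M. I \<subseteq> X}"
    unfolding matroid_rank_def using finite_indeps empty_indep by (intro Max_in) auto
  then show thesis using that by auto
qed

lemma rank_mono: "X \<subseteq> Y \<Longrightarrow> matroid_rank M X \<le> matroid_rank M Y"
  by (metis card_le_rank rank_attained subset_trans)

lemma rank_le_card: "finite X \<Longrightarrow> matroid_rank M X \<le> card X"
  by (metis card_mono rank_attained)

lemma rank_indep: "I \<in> indeps M \<Longrightarrow> matroid_rank M I = card I"
  by (simp add: card_le_rank finite_indep le_antisym rank_le_card)

lemma indep_if_card_le_rank:
  assumes "finite X" "card X \<le> matroid_rank M X"
  shows "X \<in> indeps M"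
  by (metis assms card_seteq rank_attained)

text \<open>A largest independent set between \<open>I\<close> and \<open>X\<close> already has the
  rank of \<open>X\<close>: otherwise augmenting it from a set that attains this rank would give a
  larger one.\<close>

lemma indep_extend:
  assumes I: "I \<in> indeps M" "I \<subseteq> X"
  obtains J where "J \<in> indeps M" "I \<subseteq> J" "J \<subseteq> X" "card J = matroid_rank M X"
proof -
  let ?A = "{J \<in> indeps M. I \<subseteq> J \<and> J \<subseteq> X}"
  have fin: "finite (card ` ?A)" and "card ` ?A \<noteq> {}" using I finite_indeps by auto
  then have "Max (card ` ?A) \<in> card ` ?A" by (rule Max_in)
  then obtain J where J: "J \<in> ?A" and "card J = Max (card ` ?A)" by force
  then have max: "card K \<le> card J" if "K \<in> ?A" for K
    using fin that by simp
  have "\<not> card J < matroid_rank M X"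
  proof
    assume less: "card J < matroid_rank M X"
    obtain K where "K \<in> indeps M" "K \<subseteq> X" "card K = matroid_rank M X" by (rule rank_attained)
    then obtain x where x: "x \<in> K - J" "insert x J \<in> indeps M" "x \<in> X"
      using augment[of J K] J less by auto
    then have "card (insert x J) \<le> card J" using J by (intro max) auto
    then show False using x J finite_indep by auto
  qed
  then show thesis using that J card_le_rank[of J X] by auto
qed

text \<open>Extend a maximum independent subset \<open>I\<close> of the intersection to a maximum
  independent subset \<open>J\<close> of the union. Counting \<open>J\<close> inside
  \<open>X\<close> and inside \<open>Y\<close> counts at least \<open>I\<close> twice, and both
  traces of \<open>J\<close> are independent.\<close>

lemma rank_submodular:
  "matroid_rank M (X \<union> Y) + matroid_rank M (X \<inter> Y) \<le> matroid_rank M X + matroid_rank M Y"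
proof -
  obtain I where I: "I \<in> indeps M" "I \<subseteq> X \<inter> Y" "card I = matroid_rank M (X \<inter> Y)"
    by (rule rank_attained)
  then obtain J where J: "J \<in> indeps M" "I \<subseteq> J" "J \<subseteq> X \<union> Y" "card J = matroid_rank M (X \<union> Y)"
    using indep_extend[of I "X \<union> Y"] by blast
  have fin: "finite J" using J finite_indep by blast
  have "card J + card I \<le> card ((J \<inter> X) \<union> (J \<inter> Y)) + card ((J \<inter> X) \<inter> (J \<inter> Y))"
    using I J fin by (intro add_mono card_mono) auto
  also have "\<dots> = card (J \<inter> X) + card (J \<inter> Y)"
    using fin card_Un_Int[of "J \<inter> X" "J \<inter> Y"] by simp
  also have "\<dots> \<le> matroid_rank M X + matroid_rank M Y"
    using J indep_subset by (intro add_mono card_le_rank) auto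
  finally show ?thesis using I J by simp
qed

text \<open>Elements of \<open>A\<close> are added one at a time. Since \<open>X \<union> A\<close>
  and \<open>insert a X\<close> both contain \<open>X\<close>, submodularity shows that
  \<open>a\<close> raises the rank of \<open>X \<union> A\<close> no more than that of
  \<open>X\<close>, hence not at all.\<close>

lemma rank_Un_closure:
  assumes "A \<subseteq> matroid_closure M X"
  shows "matroid_rank M (X \<union> A) = matroid_rank M X"
proof -
  have "finite A"
    using assms finite_ground by (auto simp: matroid_closure_def intro: finite_subset)
  then show ?thesis using assms
  proof (induction A)
    case (insert a A)
    have "matroid_rank M ((X \<union> A) \<union> insert a X) + matroid_rank M ((X \<union> A) \<inter> insert a X)
        \<le> matroid_rank M (X \<union> A) + matroid_rank M (insert a X)"
      by (rule rank_submodular)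
    moreover have "(X \<union> A) \<union> insert a X = X \<union> insert a A" by auto
    moreover have "matroid_rank M X \<le> matroid_rank M ((X \<union> A) \<inter> insert a X)"
      by (intro rank_mono) auto
    moreover have "matroid_rank M X \<le> matroid_rank M (X \<union> insert a A)" by (intro rank_mono) auto
    moreover have "matroid_rank M (insert a X) = matroid_rank M X"
      using insert.prems by (auto simp: matroid_closure_def)
    ultimately show ?case using insert by auto
  qed simp
qed

lemma closure_mono:
  assumes "X \<subseteq> Y"
  shows "matroid_closure M X \<subseteq> matroid_closure M Y"
proof
  fix e assume e: "e \<in> matroid_closure M X"
  have "matroid_rank M (insert e X \<union> Y) + matroid_rank M (insert e X \<inter> Y)
      \<le> matroid_rank M (insert e X) + matroid_rank M Y"
    by (rule rank_submodular)
  moreover have "insert e X \<union> Y = insert e Y" using assms by auto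
  moreover have "matroid_rank M X \<le> matroid_rank M (insert e X \<inter> Y)"
    using assms by (intro rank_mono) auto
  moreover have "matroid_rank M Y \<le> matroid_rank M (insert e Y)" by (intro rank_mono) auto
  ultimately show "e \<in> matroid_closure M Y" using e by (auto simp: matroid_closure_def)
qed

lemma rank_le_if_subset_closure:
  "A \<subseteq> matroid_closure M X \<Longrightarrow> matroid_rank M A \<le> matroid_rank M X"
  by (metis rank_Un_closure rank_mono sup_ge2)

lemma closure_trans:
  assumes A: "A \<subseteq> matroid_closure M X" and e: "e \<in> matroid_closure M A"
  shows "e \<in> matroid_closure M X"
proof -
  have "e \<in> matroid_closure M (X \<union> A)" using e closure_mono[of A "X \<union> A"] by auto
  then have "matroid_rank M (insert e (X \<union> A)) = matroid_rank M X"
    using A rank_Un_closure by (simp add: matroid_closure_def)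
  moreover have "matroid_rank M (insert e X) \<le> matroid_rank M (insert e (X \<union> A))"
    by (intro rank_mono) auto
  moreover have "matroid_rank M X \<le> matroid_rank M (insert e X)" by (intro rank_mono) auto
  ultimately show ?thesis using e by (auto simp: matroid_closure_def)
qed

text \<open>Start from the rank of \<open>T \<union> S\<close>, which is
  \<open>card S + card T\<close>, then exchange \<open>S\<close> for \<open>I\<close> and
  \<open>T\<close> for \<open>J\<close>. Each exchange loses at most the difference of the two
  ranks, which leaves at least \<open>card I + card J\<close>.\<close>

lemma indep_Un_skew:
  assumes ST: "S \<union> T \<in> indeps M" "S \<inter> T = {}"
    and I: "I \<in> indeps M" "I \<subseteq> matroid_closure M S"
    and J: "J \<in> indeps M" "J \<subseteq> matroid_closure M T"
  shows "I \<union> J \<in> indeps M"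
proof -
  \<comment> \<open>Submodularity for \<open>X \<union> A\<close> and \<open>S \<union> A\<close>,
    where the latter has the rank of \<open>S\<close> because \<open>S\<close> spans
    \<open>A\<close>.\<close>
  have exchange: "matroid_rank M (X \<union> S) + matroid_rank M A
      \<le> matroid_rank M (X \<union> A) + matroid_rank M S"
    if "A \<subseteq> matroid_closure M S" for A S X
  proof -
    have "matroid_rank M (X \<union> S) \<le> matroid_rank M ((X \<union> A) \<union> (S \<union> A))"
      by (intro rank_mono) auto
    moreover have "matroid_rank M A \<le> matroid_rank M ((X \<union> A) \<inter> (S \<union> A))"
      by (intro rank_mono) auto
    moreover note rank_submodular[of "X \<union> A" "S \<union> A"] rank_Un_closure[OF that]
    ultimately show ?thesis by linarith
  qed
  have fin: "finite S" "finite T" "finite I" "finite J"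
    using ST I J finite_indep by auto
  have ranks: "matroid_rank M S = card S" "matroid_rank M T = card T"
    "matroid_rank M (T \<union> S) = card S + card T"
    "matroid_rank M I = card I" "matroid_rank M J = card J"
    using ST I J fin indep_subset
    by (auto intro!: rank_indep simp: card_Un_disjoint Un_commute rank_indep)
  have "card I + card J \<le> matroid_rank M (I \<union> J)"
    using exchange[OF I(2), of T] exchange[OF J(2), of I] ranks by (simp add: Un_commute)
  then have "card (I \<union> J) \<le> matroid_rank M (I \<union> J)"
    using card_Un_le order_trans by blast
  then show ?thesis using fin indep_if_card_le_rank by auto
qed

text \<open>Minimality of a support inside the basis becomes a statement about the whole basis. If
  \<open>V - {w}\<close> spanned \<open>e\<close>, then \<open>?X\<close> and \<open>?Y\<close>
  would have ranks \<open>card V - 1\<close> and \<open>card S\<close>. Their union contains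
  \<open>V\<close>, and their intersection has rank at least \<open>card S\<close> because
  \<open>S - {w}\<close> does not span \<open>e\<close>; this contradicts submodularity.\<close>

lemma notin_closure_remove_support:
  assumes V: "V \<in> indeps M" and w: "w \<in> S" and S: "S \<subseteq> V"
    and e: "e \<in> matroid_closure M S" "e \<notin> matroid_closure M (S - {w})"
  shows "e \<notin> matroid_closure M (V - {w})"
proof
  assume cl: "e \<in> matroid_closure M (V - {w})"
  let ?X = "insert e (V - {w})" and ?Y = "insert e S"
  have fin: "finite V" "finite S" using V S finite_indep finite_subset by auto
  have "matroid_rank M (S - {w}) \<noteq> matroid_rank M (insert e (S - {w}))"
    using e by (auto simp: matroid_closure_def)
  moreover have "matroid_rank M (S - {w}) \<le> matroid_rank M (insert e (S - {w}))"
    by (intro rank_mono) auto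
  moreover have "matroid_rank M (insert e (S - {w})) \<le> matroid_rank M (?X \<inter> ?Y)"
    using S by (intro rank_mono) auto
  moreover have "matroid_rank M (S - {w}) = card S - 1" "matroid_rank M S = card S"
    using indep_subset[OF V] S w fin by (auto simp: rank_indep subset_insertI2 Diff_subset_conv)
  moreover have "card V \<le> matroid_rank M (?X \<union> ?Y)"
    using V S w by (intro card_le_rank) auto
  moreover have "matroid_rank M ?X = card V - 1"
    using cl indep_subset[OF V, of "V - {w}"] S w fin
    by (auto simp: matroid_closure_def rank_indep card_Diff_singleton)
  moreover have "matroid_rank M ?Y = matroid_rank M S"
    using e by (auto simp: matroid_closure_def)
  moreover have "card V > 0" "card S > 0" using S w fin card_gt_0_iff by blast+
  moreover note rank_submodular[of ?X ?Y]
  ultimately show False by linarith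
qed

end

lemma rank_delete:
  assumes "X \<inter> D = {}"
  shows "matroid_rank (matroid_delete M D) X = matroid_rank M X"
proof -
  have "{I \<in> indeps (matroid_delete M D). I \<subseteq> X} = {I \<in> indeps M. I \<subseteq> X}"
    using assms by (auto simp: matroid_delete_def)
  then show ?thesis by (simp add: matroid_rank_def)
qed


section \<open>Connected edge sets\<close>

lemma multigraph_edge_subgraph:
  assumes "multigraph G" "C \<subseteq> edges G"
  shows "multigraph (edge_subgraph G C)"
proof -
  interpret multigraph G by fact
  show ?thesis
    using assms(2) finite_edges finite_verts ends_in_verts card_ends
    by unfold_locales (auto simp: edge_subgraph_def intro: finite_subset)
qed

lemma components_connected:
  assumes "multigraph G" "connected_graph G"
  shows "components G \<subseteq> {G}"
  using assms by (auto simp: components_def is_subgraph_def)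

text \<open>Replaces paths by splittings of the edge set, the form in which circuits can be tested.
  If \<open>v\<close> is not reachable from \<open>u\<close>, the edges inside the set reached from
  \<open>u\<close> and the edges avoiding it form a forbidden splitting.\<close>

lemma connected_edge_subgraphI:
  assumes G: "multigraph G" and C: "C \<subseteq> edges G" "C \<noteq> {}"
    and split: "\<And>A B. A \<union> B = C \<Longrightarrow> A \<noteq> {} \<Longrightarrow> B \<noteq> {} \<Longrightarrow>
      (\<Union>e \<in> A. ends G e) \<inter> (\<Union>e \<in> B. ends G e) \<noteq> {}"
  shows "connected_graph (edge_subgraph G C)"
proof -
  interpret multigraph G by fact
  let ?K = "edge_subgraph G C"
  have ends: "\<exists>u v. ends G e = {u, v}" if "e \<in> C" for e
    using card_ends[of e] C that by (metis card_1_singletonE card_2_iff insert_absorb2 subsetD)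
  have "verts ?K \<noteq> {}" using C ends by (fastforce simp: edge_subgraph_def)
  moreover have "(u, v) \<in> (adjacency ?K)\<^sup>*" if u: "u \<in> verts ?K" and v: "v \<in> verts ?K" for u v
  proof (rule ccontr)
    assume uv: "(u, v) \<notin> (adjacency ?K)\<^sup>*"
    define U where "U = {w. (u, w) \<in> (adjacency ?K)\<^sup>*}"
    define A where "A = {e \<in> C. ends G e \<subseteq> U}"
    define B where "B = {e \<in> C. ends G e \<inter> U = {}}"
    \<comment> \<open>An edge that meets \<open>U\<close> lies within \<open>U\<close>, so every
      edge of \<open>C\<close> falls into \<open>A\<close> or \<open>B\<close>.\<close>
    have step: "y \<in> U" if "e \<in> C" "x \<in> ends G e" "y \<in> ends G e" "x \<in> U" for e x y
    proof (cases "x = y")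
      case False
      then have "ends G e = {x, y}" using ends[of e] that by auto
      then have "(x, y) \<in> adjacency ?K"
        using that by (auto simp: adjacency_def edge_subgraph_def)
      then show ?thesis using that by (auto simp: U_def)
    qed (use that in simp)
    have "A \<union> B = C" using step unfolding A_def B_def by blast
    moreover have "u \<in> U" "v \<notin> U" using uv by (auto simp: U_def)
    moreover obtain e where "e \<in> C" "u \<in> ends G e" using u by (auto simp: edge_subgraph_def)
    moreover obtain e' where "e' \<in> C" "v \<in> ends G e'" using v by (auto simp: edge_subgraph_def)
    ultimately have "A \<noteq> {}" "B \<noteq> {}" "A \<union> B = C"
      by (auto simp: A_def B_def)
    moreover have "(\<Union>e \<in> A. ends G e) \<inter> (\<Union>e \<in> B. ends G e) = {}"
      unfolding A_def B_def by blast
    ultimately show False using split by blast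
  qed
  ultimately show ?thesis by (auto simp: connected_graph_def)
qed


section \<open>The graph of a framed matroid\<close>

text \<open>A spanning subset of \<open>V\<close> of least cardinality will do. These sets become
  the ends of the edges.\<close>

lemma minimal_support:
  assumes "framed_matroid M V" "e \<in> ground M"
  obtains S where "S \<subseteq> V" "card S \<le> 2" "e \<in> matroid_closure M S"
    "\<And>w. w \<in> S \<Longrightarrow> e \<notin> matroid_closure M (S - {w})"
proof -
  interpret matroid M using assms by (simp add: framed_matroid_def)
  let ?P = "\<lambda>S. S \<subseteq> V \<and> card S \<le> 2 \<and> e \<in> matroid_closure M S"
  have "\<exists>S. ?P S" using assms by (auto simp: framed_matroid_def)
  then obtain S where S: "?P S" and min: "\<And>T. ?P T \<Longrightarrow> card S \<le> card T"
    using ex_has_least_nat[of ?P _ card] by metis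
  have "finite S"
    using S assms finite_indep finite_subset by (auto simp: framed_matroid_def matroid_basis_def)
  have "e \<notin> matroid_closure M (S - {w})" if "w \<in> S" for w
  proof
    assume "e \<in> matroid_closure M (S - {w})"
    moreover have less: "card (S - {w}) < card S"
      using \<open>finite S\<close> that by (rule card_Diff1_less)
    ultimately have "card S \<le> card (S - {w})" using S by (intro min) auto
    then show False using less by simp
  qed
  then show thesis using that S by blast
qed

text \<open>The injection \<open>f\<close> lets \<open>M\<close> and \<open>M'\<close> live on
  different types; the theorem takes \<open>Inl\<close> for it.\<close>

lemma framework_of_framed_matroid:
  fixes M :: "'a pre_matroid" and M' :: "'b pre_matroid"
  assumes M: "matroid M" and framed: "framed_matroid M' V"
    and inj: "inj_on f (ground M)" and eq: "map_matroid f M = matroid_delete M' V"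
  shows "\<exists>G :: (nat, 'a) pre_multigraph. framework G M"
proof -
  interpret M: matroid M by fact
  interpret M': matroid M' using framed by (simp add: framed_matroid_def)
  have V: "V \<in> indeps M'" using framed by (simp add: framed_matroid_def matroid_basis_def)
  then have finV: "finite V" by (rule M'.finite_indep)
  have gr: "f ` ground M = ground M' - V"
    and ind: "(`) f ` indeps M = {I \<in> indeps M'. I \<inter> V = {}}"
    using eq by (auto simp: map_matroid_def matroid_delete_def)

  \<comment> \<open>Transfer of rank, closure and independence along \<open>f\<close>\<close>
  have rank: "matroid_rank M X = matroid_rank M' (f ` X)" if X: "X \<subseteq> ground M" for X
    using rank_map[OF M inj X] rank_delete[of "f ` X" V M'] gr X eq by auto
  have closure: "f e \<in> matroid_closure M' (f ` X)" if "e \<in> matroid_closure M X" "X \<subseteq> ground M" for e X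
    using that rank[of X] rank[of "insert e X"] gr by (auto simp: matroid_closure_def)
  have indep: "f ` I \<in> indeps M' \<longleftrightarrow> I \<in> indeps M" if I: "I \<subseteq> ground M" for I
  proof
    assume "f ` I \<in> indeps M'"
    moreover have "f ` I \<inter> V = {}" using gr I by auto
    ultimately have "f ` I \<in> (`) f ` indeps M" unfolding ind by simp
    then obtain J where J: "J \<in> indeps M" "f ` I = f ` J" by (elim imageE)
    then have "I = J" using inj_on_image_eq_iff[OF inj I M.indeps_subset] by simp
    then show "I \<in> indeps M" using J by simp
  next
    assume "I \<in> indeps M"
    then have "f ` I \<in> (`) f ` indeps M" by (rule imageI)
    then show "f ` I \<in> indeps M'" unfolding ind by simp
  qed

  have "\<forall>e \<in> ground M. \<exists>S. S \<subseteq> V \<and> card S \<le> 2 \<and> f e \<in> matroid_closure M' S \<and>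
      (\<forall>w \<in> S. f e \<notin> matroid_closure M' (S - {w}))"
    using minimal_support[OF framed] gr by (metis DiffD1 imageI)
  then obtain S where S: "\<And>e. e \<in> ground M \<Longrightarrow> S e \<subseteq> V" "\<And>e. e \<in> ground M \<Longrightarrow> card (S e) \<le> 2"
    "\<And>e. e \<in> ground M \<Longrightarrow> f e \<in> matroid_closure M' (S e)"
    and min: "\<And>e w. e \<in> ground M \<Longrightarrow> w \<in> S e \<Longrightarrow> f e \<notin> matroid_closure M' (S e - {w})"
    by metis
  \<comment> \<open>All three conditions on the graph are derived from this: a set of edges is
    spanned by the union of its supports.\<close>
  have span: "f ` X \<subseteq> matroid_closure M' (\<Union>e \<in> X. S e)" if "X \<subseteq> ground M" for X
    using S(3) that M'.closure_mono[of "S _" "\<Union>e \<in> X. S e"] by fast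

  obtain g :: "'b \<Rightarrow> nat" where g: "inj_on g V"
    using finite_imp_inj_to_nat_seg[OF finV] by auto
  \<comment> \<open>Inserting \<open>0\<close> guarantees that the default end is a vertex, whether
    or not \<open>g\<close> takes the value \<open>0\<close> on \<open>V\<close>.\<close>
  define G where "G = \<lparr>verts = insert 0 (g ` V), edges = ground M,
    ends = \<lambda>e. if S e = {} then {0} else g ` S e\<rparr>"
  have edges_G: "edges G = ground M"
    and ends_G: "\<And>e. ends G e = (if S e = {} then {0} else g ` S e)"
    and verts_G: "verts G = insert 0 (g ` V)"
    by (auto simp: G_def)
  have card_ends: "card (ends G e) = 1 \<or> card (ends G e) = 2" if "e \<in> ground M" for e
  proof -
    have "card (g ` S e) = card (S e)" "finite (S e)"
      using S(1)[OF that] g finV by (auto intro: card_image inj_on_subset finite_subset)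
    then show ?thesis using S(2)[OF that] by (cases "card (S e)") (auto simp: ends_G)
  qed
  interpret G: multigraph G
    by unfold_locales
      (use M.finite_ground finV S(1) card_ends in \<open>auto simp: edges_G ends_G verts_G split: if_splits\<close>)
  have G: "multigraph G" ..

  \<comment> \<open>The rank of a component\<close>
  have "matroid_rank M (edges H) \<le> card (verts H)" if "H \<in> components G" for H
  proof -
    interpret H: multigraph H using that by (simp add: components_def is_subgraph_def)
    have H: "edges H \<subseteq> ground M" "ends H = ends G"
      using that by (auto simp: components_def is_subgraph_def edges_G)
    let ?U = "\<Union>e \<in> edges H. S e"
    have U: "?U \<subseteq> V" using S(1) H by auto
    have "matroid_rank M (edges H) \<le> matroid_rank M' ?U"
      using H span M'.rank_le_if_subset_closure by (simp add: rank)
    also have "\<dots> \<le> card ?U" using U finV by (intro M'.rank_le_card) (rule finite_subset)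
    also have "\<dots> = card (g ` ?U)" using U g by (metis card_image inj_on_subset)
    \<comment> \<open>An element of \<open>?U\<close> lies in a nonempty support, so its image under
      \<open>g\<close> is an end of an edge of \<open>H\<close>.\<close>
    also have "\<dots> \<le> card (verts H)"
      using H H.ends_in_verts by (intro card_mono H.finite_verts) (fastforce simp: ends_G)
    finally show ?thesis .
  qed

  \<comment> \<open>The closure condition at a vertex\<close>
  moreover have "matroid_closure M (edges (delete_vertex G v)) \<subseteq> edges (delete_vertex G v) \<union> loops G v"
    for v
  proof
    fix e assume e: "e \<in> matroid_closure M (edges (delete_vertex G v))"
    let ?X = "edges (delete_vertex G v)"
    have X: "?X \<subseteq> ground M" by (auto simp: delete_vertex_def edges_G)
    have eM: "e \<in> ground M" using e by (simp add: matroid_closure_def)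
    show "e \<in> ?X \<union> loops G v"
    proof (rule ccontr)
      assume "e \<notin> ?X \<union> loops G v"
      then have "v \<in> ends G e" "ends G e \<noteq> {v}"
        using eM by (auto simp: delete_vertex_def loops_def edges_G)
      \<comment> \<open>The default end is excluded here: an empty support would make
        \<open>e\<close> a graph loop at \<open>v\<close>.\<close>
      then obtain w where w: "w \<in> S e" "v = g w" by (auto simp: ends_G split: if_splits)
      have "w \<notin> S e'" if "e' \<in> ?X" for e'
        using that w by (auto simp: delete_vertex_def ends_G split: if_splits)
      \<comment> \<open>Hence \<open>V - {w}\<close> spans all edges that avoid \<open>v\<close> and
        so their closure, but by minimality of \<open>S e\<close> it does not span
        \<open>f e\<close>.\<close>
      then have "(\<Union>e' \<in> ?X. S e') \<subseteq> V - {w}" using X S(1) by blast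
      then have "f ` ?X \<subseteq> matroid_closure M' (V - {w})"
        using span[OF X] M'.closure_mono by blast
      then have "f e \<in> matroid_closure M' (V - {w})"
        using closure[OF e X] M'.closure_trans by blast
      then show False
        using M'.notin_closure_remove_support[OF V w(1) S(1)[OF eM] S(3)[OF eM] min[OF eM w(1)]] by blast
    qed
  qed

  \<comment> \<open>Components of circuits\<close>
  moreover have "card (components (edge_subgraph G C)) \<le> 2" if C: "matroid_circuit M C" for C
  proof -
    have CM: "C \<subseteq> ground M" "C \<notin> indeps M" and sub: "\<And>D. D \<subset> C \<Longrightarrow> D \<in> indeps M"
      using C by (auto simp: matroid_circuit_def)
    have "connected_graph (edge_subgraph G C)"
    proof (rule connected_edge_subgraphI[OF G])
      show "C \<subseteq> edges G" "C \<noteq> {}" using CM M.empty_indep by (auto simp: edges_G)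
      fix A B assume AB: "A \<union> B = C" "A \<noteq> {}" "B \<noteq> {}"
      show "(\<Union>e \<in> A. ends G e) \<inter> (\<Union>e \<in> B. ends G e) \<noteq> {}"
      proof
        assume disj: "(\<Union>e \<in> A. ends G e) \<inter> (\<Union>e \<in> B. ends G e) = {}"
        have "ends G e \<noteq> {}" for e by (simp add: ends_G)
        \<comment> \<open>Being disjoint and nonempty, \<open>A\<close> and \<open>B\<close> are
          proper subsets of the circuit \<open>C\<close> and thus independent.\<close>
        then have "A \<inter> B = {}" using disj by fast
        then have indAB: "A \<in> indeps M" "B \<in> indeps M" using AB by (auto intro!: sub)
        have ABM: "A \<subseteq> ground M" "B \<subseteq> ground M" using AB CM by auto
        \<comment> \<open>The inclusion can be strict because of the default end \<open>0\<close>,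
          but it suffices to pass from disjoint ends to disjoint supports.\<close>
        have gS: "g ` (\<Union>e \<in> X. S e) \<subseteq> (\<Union>e \<in> X. ends G e)" for X
          by (auto simp: ends_G)
        have "(\<Union>e \<in> A. S e) \<inter> (\<Union>e \<in> B. S e) = {}"
        proof (rule equals0I)
          fix w assume "w \<in> (\<Union>e \<in> A. S e) \<inter> (\<Union>e \<in> B. S e)"
          then have "g w \<in> (\<Union>e \<in> A. ends G e) \<inter> (\<Union>e \<in> B. ends G e)"
            using gS[of A] gS[of B] by (meson IntD1 IntD2 IntI imageI subsetD)
          then show False unfolding disj by simp
        qed
        moreover have "(\<Union>e \<in> A. S e) \<union> (\<Union>e \<in> B. S e) \<in> indeps M'"
          using ABM S(1) by (intro M'.indep_subset[OF V]) blast
        ultimately have "f ` A \<union> f ` B \<in> indeps M'"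
          using M'.indep_Un_skew span[OF ABM(1)] span[OF ABM(2)] indAB indep[OF ABM(1)] indep[OF ABM(2)]
          by simp
        then show False using indep[OF CM(1)] CM(2) AB(1) by (metis image_Un)
      qed
    qed
    then have "components (edge_subgraph G C) \<subseteq> {edge_subgraph G C}"
      using CM by (intro components_connected multigraph_edge_subgraph G) (auto simp: edges_G)
    then have "card (components (edge_subgraph G C)) \<le> card {edge_subgraph G C}"
      by (rule card_mono[rotated]) simp
    then show ?thesis by simp
  qed
  ultimately have "framework G M" using G by (auto simp: framework_def edges_G)
  then show ?thesis by blast
qed

theorem theorem1p3:
  fixes M :: "'a pre_matroid"
  assumes "frame_matroid M"
  shows "quasi_graphic M"
  using assms framework_of_framed_matroid[of M _ _ Inl]
  by (auto simp: frame_matroid_def quasi_graphic_def)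

end
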